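(* Let $M$ be a complete convex surface of bounded specific curvature in $\mathbb{R}^3$, let $ABCD\subset M$ be a convex quadrilateral of perimeter less than $2\pi/\sqrt{K_1}$, and let $P_F$ be a point in the interior of $ABCD$ which also lies in the interior of the triangle $\triangle ABC$. Let $c>0$ be a constant, and let $(w_A)_{ABCD},(w_B)_{ABCD},(w_C)_{ABCD},(w_D)_{ABCD}$ be any positive weights that solve the 4-inverse weighted Fermat-Torricelli problem for $ABCD$, $P_F$ and $c$ (that is, they have sum $c$ and $P_F$ is the corresponding weighted Fermat-Torricelli point of $ABCD$). Then $$\left(\frac{w_B}{w_A}\right)_{ABCD}=\left(\frac{w_B}{w_A}\right)_{ABC}\left[1-\left(\frac{w_D}{w_A}\right)_{ABCD}\left(\frac{w_A}{w_D}\right)_{ACD}\right],$$ $$\left(\frac{w_C}{w_A}\right)_{ABCD}=\left(\frac{w_C}{w_A}\right)_{ABC}\left[1-\left(\frac{w_D}{w_A}\right)_{ABCD}\left(\frac{w_A}{w_D}\right)_{ABD}\right],$$ and $$(w_A)_{ABCD}+(w_B)_{ABCD}+(w_C)_{ABCD}+(w_D)_{ABCD}=c .$$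
   Context: A convex surface is the whole boundary of a convex body in $\mathbb{R}^3$. For a domain $W$ on it, with curvature $\omega(W)=\iint_W K\,dS$ and area $S(W)$, the specific curvature is $\kappa(W)=\omega(W)/S(W)$. The surface $M$ is complete and has bounded specific curvature: there are constants $0<K_1<K_2$ with $K_1<\kappa(W)<K_2$ for domains $W$. A convex quadrilateral $ABCD$ has vertices $A,B,C,D$ in this cyclic order and sides that are shortest arcs. For positive weights $w_A,w_B,w_C,w_D$ attached to the vertices, a weighted Fermat-Torricelli point is a point $P_F$ of $M$ minimizing $f(P)=w_Al_A+w_Bl_B+w_Cl_C+w_Dl_D$, where $l_R$ is the length of the shortest arc from $P$ to the vertex $R$. 4-inverse weighted Fermat-Torricelli problem: given a point $P$ in the interior of $ABCD$ and a constant $c>0$, find positive weights with $w_A+w_B+w_C+w_D=c$ for which $P$ minimizes $f$. Solutions with $P=P_F$ are denoted $(w_R)_{ABCD}$, $R\in\{A,B,C,D\}$, and $\left(\frac{w_R}{w_S}\right)_{ABCD}=(w_R)_{ABCD}/(w_S)_{ABCD}$. Let $u_R$ be the unit vector at $P_F$ tangent to the shortest arc $P_FR$ (the tangent cone at $P_F$ is a plane; the complete angle at $P_F$ is $2\pi$). For distinct $S,L,N\in\{A,B,C,D\}$, the numbers $(w_S)_{SLN},(w_L)_{SLN},(w_N)_{SLN}$ are the solution of the 3-inverse weighted Fermat-Torricelli problem for the triangle $\triangle SLN$ at $P_F$: the real numbers with sum $c$ and $(w_S)_{SLN}u_S+(w_L)_{SLN}u_L+(w_N)_{SLN}u_N=0$.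 They are positive if $P_F$ is in the interior of $\triangle SLN$; otherwise some may be negative or zero. Write $\left(\frac{w_S}{w_L}\right)_{SLN}=(w_S)_{SLN}/(w_L)_{SLN}$. Equivalently, with angles at $P_F$ oriented counterclockwise, $\left(\frac{w_B}{w_A}\right)_{ABC}=-\frac{\sin\angle CP_FA}{\sin\angle CP_FB}$, $\left(\frac{w_C}{w_A}\right)_{ABC}=-\frac{\sin\angle BP_FA}{\sin\angle BP_FC}$, $\left(\frac{w_A}{w_D}\right)_{ACD}=-\frac{\sin\angle CP_FD}{\sin\angle CP_FA}$, $\left(\frac{w_A}{w_D}\right)_{ABD}=-\frac{\sin\angle BP_FD}{\sin\angle BP_FA}$. *)

theory Defs
  imports "HOL-Analysis.Analysis"
begin

text \<open>
  The convex body is closed but need not be bounded, so that its whole boundary is a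
  complete surface; connectedness only excludes a pair of parallel planes.
\<close>
definition complete_convex_surface :: "(real^3) set \<Rightarrow> bool" where
  "complete_convex_surface M \<longleftrightarrow>
     (\<exists>B. convex B \<and> closed B \<and> interior B \<noteq> {} \<and> M = frontier B) \<and> connected M"

subsection \<open>Area, curvature, specific curvature\<close>

definition hausdorff2_premeasure :: "real \<Rightarrow> (real^3) set \<Rightarrow> ennreal" where
  "hausdorff2_premeasure \<delta> E =
     (INF U \<in> {U :: nat \<Rightarrow> (real^3) set. E \<subseteq> (\<Union>i. U i) \<and> (\<forall>i. bounded (U i) \<and> diameter (U i) \<le> \<delta>)}.
        \<Sum>i. ennreal (pi / 4 * (diameter (U i))\<^sup>2))"

text \<open>
  Surface area is two-dimensional Hausdorff measure; the factor \<open>pi / 4\<close> above (the area of a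
  disc of diameter 1) makes it agree with the usual area, on \<open>M\<close> and on the unit sphere.
\<close>
definition surface_area :: "(real^3) set \<Rightarrow> ennreal" where
  "surface_area E = (SUP \<delta>\<in>{0<..}. hausdorff2_premeasure \<delta> E)"

text \<open>
  All outer unit normals of supporting planes at points of \<open>W\<close>. It is enough to test against
  \<open>M\<close> instead of the body: a closed convex body other than a half-space or the whole space is the
  convex hull of its boundary (for a half-space the two normals form a set of area 0).
\<close>
definition spherical_image :: "(real^3) set \<Rightarrow> (real^3) set \<Rightarrow> (real^3) set" where
  "spherical_image M W = {n. norm n = 1 \<and> (\<exists>X\<in>W. \<forall>Y\<in>M. n \<bullet> (Y - X) \<le> 0)}"

text \<open>
  A convex surface need not be twice differentiable, so \<open>K\<close> need not exist at every point. The
  integral of \<open>K\<close> over \<open>W\<close> is understood as usual for convex surfaces: as the area of the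
  spherical image of \<open>W\<close>, which is \<open>\<integral>\<integral>\<^sub>W K dS\<close> when \<open>M\<close> is smooth.
\<close>
definition total_curvature :: "(real^3) set \<Rightarrow> (real^3) set \<Rightarrow> ennreal" where
  "total_curvature M W = surface_area (spherical_image M W)"

definition specific_curvature :: "(real^3) set \<Rightarrow> (real^3) set \<Rightarrow> ennreal" where
  "specific_curvature M W = total_curvature M W / surface_area W"

definition domain_on :: "(real^3) set \<Rightarrow> (real^3) set \<Rightarrow> bool" where
  "domain_on M W \<longleftrightarrow> openin (top_of_set M) W \<and> connected W \<and> W \<noteq> {}"

definition bounded_specific_curvature :: "(real^3) set \<Rightarrow> real \<Rightarrow> real \<Rightarrow> bool" where
  "bounded_specific_curvature M K1 K2 \<longleftrightarrow> 0 < K1 \<and> K1 < K2 \<and>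
     (\<forall>W. domain_on M W \<longrightarrow>
        ennreal K1 < specific_curvature M W \<and> specific_curvature M W < ennreal K2)"

subsection \<open>Shortest arcs\<close>

definition curve_length :: "(real \<Rightarrow> real^3) \<Rightarrow> ennreal" where
  "curve_length g =
     (SUP (n, t) \<in> {(n :: nat, t :: nat \<Rightarrow> real). t 0 = 0 \<and> t n = 1 \<and> (\<forall>i<n. t i \<le> t (Suc i))}.
        ennreal (\<Sum>i<n. dist (g (t i)) (g (t (Suc i)))))"

definition curves_on :: "(real^3) set \<Rightarrow> real^3 \<Rightarrow> real^3 \<Rightarrow> (real \<Rightarrow> real^3) set" where
  "curves_on M X Y = {g. path g \<and> path_image g \<subseteq> M \<and> pathstart g = X \<and> pathfinish g = Y}"

definition intrinsic_dist :: "(real^3) set \<Rightarrow> real^3 \<Rightarrow> real^3 \<Rightarrow> real" where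
  "intrinsic_dist M X Y = enn2real (INF g\<in>curves_on M X Y. curve_length g)"

definition shortest_arc :: "(real^3) set \<Rightarrow> real^3 \<Rightarrow> real^3 \<Rightarrow> (real \<Rightarrow> real^3) \<Rightarrow> bool" where
  "shortest_arc M X Y g \<longleftrightarrow> arc g \<and> g \<in> curves_on M X Y \<and> curve_length g < top \<and>
     (\<forall>h\<in>curves_on M X Y. curve_length g \<le> curve_length h)"

text \<open>
  The unit tangent vector of \<open>g\<close> at its starting point, as limit of the directions of chords
  (independent of the parametrization; \<open>sgn v\<close> is \<open>v\<close> divided by its norm).
\<close>
definition initial_direction :: "(real \<Rightarrow> real^3) \<Rightarrow> real^3 \<Rightarrow> bool" where
  "initial_direction g u \<longleftrightarrow> ((\<lambda>t. sgn (g t - g 0)) \<longlongrightarrow> u) (at_right 0)"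

subsection \<open>Geodesic triangles and convex quadrilaterals\<close>

definition disc_bounded_by :: "(real^3) set \<Rightarrow> (real \<Rightarrow> real^3) \<Rightarrow> bool" where
  "disc_bounded_by Q l \<longleftrightarrow>
     (\<exists>h k. homeomorphism (cball (0 :: real^2) 1) Q h k \<and> h ` sphere 0 1 = path_image l)"

definition geodesic_triangle ::
  "(real^3) set \<Rightarrow> real^3 \<Rightarrow> real^3 \<Rightarrow> real^3 \<Rightarrow> (real^3) set \<Rightarrow> bool" where
  "geodesic_triangle M A B C T \<longleftrightarrow> T \<subseteq> M \<and>
     (\<exists>a b c. shortest_arc M A B a \<and> shortest_arc M B C b \<and> shortest_arc M C A c \<and>
        simple_path (a +++ b +++ c) \<and> disc_bounded_by T (a +++ b +++ c))"

definition geodesically_convex :: "(real^3) set \<Rightarrow> (real^3) set \<Rightarrow> bool" where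
  "geodesically_convex M Q \<longleftrightarrow>
     (\<forall>X\<in>Q. \<forall>Y\<in>Q. X \<noteq> Y \<longrightarrow> (\<exists>g. shortest_arc M X Y g \<and> path_image g \<subseteq> Q))"

definition convex_quadrilateral ::
  "(real^3) set \<Rightarrow> real^3 \<Rightarrow> real^3 \<Rightarrow> real^3 \<Rightarrow> real^3 \<Rightarrow> (real^3) set \<Rightarrow> bool" where
  "convex_quadrilateral M A B C D Q \<longleftrightarrow> Q \<subseteq> M \<and>
     (\<exists>a b c d. shortest_arc M A B a \<and> shortest_arc M B C b \<and>
        shortest_arc M C D c \<and> shortest_arc M D A d \<and>
        simple_path (a +++ b +++ c +++ d) \<and> disc_bounded_by Q (a +++ b +++ c +++ d)) \<and>
     geodesically_convex M Q"

definition perimeter4 :: "(real^3) set \<Rightarrow> real^3 \<Rightarrow> real^3 \<Rightarrow> real^3 \<Rightarrow> real^3 \<Rightarrow> real" where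
  "perimeter4 M A B C D =
     intrinsic_dist M A B + intrinsic_dist M B C + intrinsic_dist M C D + intrinsic_dist M D A"

text \<open>The interior of a region \<open>Q\<close> of the surface, relative to \<open>M\<close>.\<close>
abbreviation surface_interior :: "(real^3) set \<Rightarrow> (real^3) set \<Rightarrow> (real^3) set" where
  "surface_interior M Q \<equiv> top_of_set M interior_of Q"

subsection \<open>Weighted Fermat-Torricelli problems\<close>

definition ft_objective ::
  "(real^3) set \<Rightarrow> real^3 \<Rightarrow> real^3 \<Rightarrow> real^3 \<Rightarrow> real^3 \<Rightarrow>
   real \<Rightarrow> real \<Rightarrow> real \<Rightarrow> real \<Rightarrow> real^3 \<Rightarrow> real" where
  "ft_objective M A B C D wA wB wC wD X =
     wA * intrinsic_dist M X A + wB * intrinsic_dist M X B +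
     wC * intrinsic_dist M X C + wD * intrinsic_dist M X D"

definition ft_point ::
  "(real^3) set \<Rightarrow> real^3 \<Rightarrow> real^3 \<Rightarrow> real^3 \<Rightarrow> real^3 \<Rightarrow>
   real \<Rightarrow> real \<Rightarrow> real \<Rightarrow> real \<Rightarrow> real^3 \<Rightarrow> bool" where
  "ft_point M A B C D wA wB wC wD P \<longleftrightarrow> P \<in> M \<and>
     (\<forall>X\<in>M. ft_objective M A B C D wA wB wC wD P \<le> ft_objective M A B C D wA wB wC wD X)"

definition inverse_ft4 ::
  "(real^3) set \<Rightarrow> real^3 \<Rightarrow> real^3 \<Rightarrow> real^3 \<Rightarrow> real^3 \<Rightarrow> real^3 \<Rightarrow> real \<Rightarrow>
   real \<Rightarrow> real \<Rightarrow> real \<Rightarrow> real \<Rightarrow> bool" where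
  "inverse_ft4 M A B C D P c wA wB wC wD \<longleftrightarrow>
     0 < wA \<and> 0 < wB \<and> 0 < wC \<and> 0 < wD \<and> wA + wB + wC + wD = c \<and>
     ft_point M A B C D wA wB wC wD P"

text \<open>
  \<open>wS\<close>, \<open>wL\<close>, \<open>wN\<close> are the (only) solution of the 3-inverse problem with unit vectors
  \<open>uS\<close>, \<open>uL\<close>, \<open>uN\<close> towards the vertices. For \<open>c > 0\<close> and coplanar unit vectors there is exactly
  one solution if and only if the three vectors are distinct.
\<close>
definition inverse_ft3 ::
  "real \<Rightarrow> real^3 \<Rightarrow> real^3 \<Rightarrow> real^3 \<Rightarrow> real \<Rightarrow> real \<Rightarrow> real \<Rightarrow> bool" where
  "inverse_ft3 c uS uL uN wS wL wN \<longleftrightarrow>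
     (\<forall>x y z. x + y + z = c \<and> x *\<^sub>R uS + y *\<^sub>R uL + z *\<^sub>R uN = 0 \<longleftrightarrow>
        x = wS \<and> y = wL \<and> z = wN)"

end

theory Submission
  imports Defs
begin

text \<open>
  Everything follows from one vector identity at the minimum point \<open>P\<close>, the balance condition
  \<open>wA u\<^sub>A + wB u\<^sub>B + wC u\<^sub>C + wD u\<^sub>D = 0\<close>. The 3-inverse problem for \<open>A, C, D\<close> says
  that \<open>u\<^sub>D\<close> is a certain combination of \<open>u\<^sub>A\<close> and \<open>u\<^sub>C\<close>. Substituting it turns the balance
  condition into a linear relation between \<open>u\<^sub>A, u\<^sub>B, u\<^sub>C\<close>. Such relations are unique up to a
  factor, so the new coefficients of \<open>u\<^sub>A\<close> and \<open>u\<^sub>B\<close> are in the ratio of the weights of the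
  3-inverse problem for \<open>A, B, C\<close>: this is the first formula. Eliminating \<open>u\<^sub>D\<close> by means of
  \<open>A, B, D\<close> gives the second (\<open>balanced_weight_ratio\<close>).

  The balance condition is the vanishing of the first variation of the objective, and it follows from
  an upper bound of that variation: if \<open>V = \<Sum> (w / c) u\<close> were not 0, the objective would
  decrease when \<open>P\<close> moves in the direction \<open>V\<close>. A convex surface need not have a tangent plane at
  a given point; what the variation needs of one is provided in two steps.

  First, \<open>P\<close> has a supporting plane containing all four directions
  (\<open>supporting_plane_through_three_directions\<close>). The 3-inverse problems are uniquely solvable, with
  nonzero weights at \<open>A\<close> for \<open>A, B, C\<close> and at \<open>D\<close> for the other two triangles. So the four
  directions span a plane, and any two of \<open>u\<^sub>A, u\<^sub>B, u\<^sub>C\<close> are linearly independent. If that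
  plane through \<open>P\<close> entered the interior of the body, its intersection with the tangent cone
  would be a planar convex cone with inner points; the boundary of such a cone consists of two rays,
  which cannot contain three directions of arcs lying on the surface. So the plane misses the interior,
  and a separating plane supports the body and contains all directions.

  Second, distances on the surface between points near \<open>P\<close> are hardly longer than chords, as long
  as these points are close to the supporting plane (\<open>short_curve_on_frontier\<close>). Near \<open>P\<close> the
  surface is a graph over its chords, in the direction from an interior point to \<open>P\<close>. Over a chord
  that lies within \<open>o(t)\<close> of the supporting plane, this graph is a concave function with values
  between 0 and \<open>o(t)\<close>. It rises and then falls, so its length exceeds that of the chord by
  \<open>o(t)\<close> only.

  These are combined in \<open>weighted_directions_balance\<close>. On every arc take the point \<open>Y\<close> at
  distance \<open>t\<close> from \<open>P\<close>, and move \<open>P\<close> to the surface point \<open>X\<close> above the weighted mean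
  \<open>Z\<close> of these points, which belongs to the body by convexity. Going to the vertex \<open>R\<close> through
  \<open>Y\<close> shows \<open>d(X,R) - d(P,R) \<le> d(X,Y) - t \<le> t (|u - V| - 1) + o(t)\<close>, and the weighted sum
  of these bounds is at most \<open>- t c |V|\<^sup>2 / 2 + o(t)\<close>.
\<close>

section \<open>Lengths of curves\<close>

definition chord_sums :: "(real \<Rightarrow> real^3) \<Rightarrow> real \<Rightarrow> real set" where
  "chord_sums g a =
     {(\<Sum>i<n. dist (g (t i)) (g (t (Suc i)))) | (n :: nat) (t :: nat \<Rightarrow> real).
        t 0 = a \<and> t n = 1 \<and> (\<forall>i<n. t i \<le> t (Suc i))}"

definition length_from :: "(real \<Rightarrow> real^3) \<Rightarrow> real \<Rightarrow> real" where
  "length_from g a = Sup (chord_sums g a)"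

text \<open>
  \<open>G\<close> grows at least as fast as the arc length of \<open>g\<close>. Exhibiting such a \<open>G\<close> bounds the length
  of a curve without additivity of length, and it is easy to do for concatenated curves.
\<close>
definition length_controlled :: "(real \<Rightarrow> real^3) \<Rightarrow> (real \<Rightarrow> real) \<Rightarrow> bool" where
  "length_controlled g G \<longleftrightarrow>
     (\<forall>a b. 0 \<le> a \<and> a \<le> b \<and> b \<le> 1 \<longrightarrow> dist (g a) (g b) \<le> G b - G a)"

lemma partition_bounds:
  fixes t :: "nat \<Rightarrow> real"
  assumes "\<forall>i<n. t i \<le> t (Suc i)" and "i \<le> n"
  shows "t 0 \<le> t i \<and> t i \<le> t n"
proof
  have "k \<le> n \<Longrightarrow> t 0 \<le> t k" for k
  proof (induction k)
    case (Suc k)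
    then have "t 0 \<le> t k" "t k \<le> t (Suc k)" using assms(1) by auto
    then show ?case by simp
  qed simp
  with assms(2) show "t 0 \<le> t i" by blast
  show "t i \<le> t n"
    using assms(2)
  proof (induction rule: inc_induct)
    case (step k)
    with assms(1) have "t k \<le> t (Suc k)" by blast
    with step.IH show ?case by simp
  qed simp
qed

lemma curve_length_le_control:
  assumes "length_controlled g G"
  shows "curve_length g \<le> ennreal (G 1 - G 0)"
  unfolding curve_length_def
proof (rule SUP_least, clarify)
  fix n :: nat and t :: "nat \<Rightarrow> real"
  assume t: "t 0 = 0" "t n = 1" "\<forall>i<n. t i \<le> t (Suc i)"
  have "(\<Sum>i<n. dist (g (t i)) (g (t (Suc i)))) \<le> (\<Sum>i<n. G (t (Suc i)) - G (t i))"
  proof (rule sum_mono)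
    fix i assume i: "i \<in> {..<n}"
    have "0 \<le> t i" "t (Suc i) \<le> 1"
      using partition_bounds[OF t(3), of i] partition_bounds[OF t(3), of "Suc i"] i t by auto
    with i t(3) assms show "dist (g (t i)) (g (t (Suc i))) \<le> G (t (Suc i)) - G (t i)"
      unfolding length_controlled_def by auto
  qed
  also have "\<dots> = G 1 - G 0"
    using t by (simp add: sum_lessThan_telescope[of "\<lambda>i. G (t i)"])
  finally show "ennreal (\<Sum>i<n. dist (g (t i)) (g (t (Suc i)))) \<le> ennreal (G 1 - G 0)"
    by (rule ennreal_leI)
qed

lemma chord_sums_prepend:
  assumes "S \<in> chord_sums g b" and "a \<le> b"
  shows "dist (g a) (g b) + S \<in> chord_sums g a"
proof -
  obtain n t where S: "S = (\<Sum>i<n. dist (g (t i)) (g (t (Suc i))))"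
    and t: "t 0 = b" "t n = 1" "\<forall>i<n. t i \<le> t (Suc i)"
    using assms(1) unfolding chord_sums_def by blast
  define t' where "t' = case_nat a t"
  have "dist (g a) (g b) + S = (\<Sum>i<Suc n. dist (g (t' i)) (g (t' (Suc i))))"
    unfolding sum.lessThan_Suc_shift by (simp add: S t'_def t)
  moreover have "t' 0 = a \<and> t' (Suc n) = 1 \<and> (\<forall>i<Suc n. t' i \<le> t' (Suc i))"
    using t assms(2) by (auto simp: t'_def split: nat.split)
  ultimately show ?thesis
    unfolding chord_sums_def by blast
qed

lemma chord_sums_nonempty:
  assumes "a \<le> 1" shows "chord_sums g a \<noteq> {}"
proof -
  have "0 \<in> chord_sums g 1"
    unfolding chord_sums_def by (auto intro!: exI[of _ "0::nat"] exI[of _ "\<lambda>_. 1"])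
  from chord_sums_prepend[OF this assms] show ?thesis by blast
qed

context
  fixes g :: "real \<Rightarrow> real^3"
  assumes rectifiable: "curve_length g < top"
begin

lemma chord_sums_le:
  assumes "S \<in> chord_sums g a" and "0 \<le> a"
  shows "dist (g 0) (g a) + S \<le> enn2real (curve_length g)"
proof -
  have "dist (g 0) (g a) + S \<in> chord_sums g 0"
    using chord_sums_prepend assms by blast
  then obtain n t where S: "dist (g 0) (g a) + S = (\<Sum>i<n. dist (g (t i)) (g (t (Suc i))))"
    and t: "t 0 = 0" "t n = 1" "\<forall>i<n. t i \<le> t (Suc i)"
    unfolding chord_sums_def by blast
  have "ennreal (dist (g 0) (g a) + S) \<le> curve_length g"
    unfolding curve_length_def S using t by (intro SUP_upper2[of "(n, t)"]) auto
  then have "enn2real (ennreal (dist (g 0) (g a) + S)) \<le> enn2real (curve_length g)"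
    using rectifiable by (intro enn2real_mono) auto
  moreover have "0 \<le> dist (g 0) (g a) + S"
    unfolding S by (intro sum_nonneg) auto
  ultimately show ?thesis by simp
qed

lemma bdd_above_chord_sums:
  assumes "0 \<le> a" shows "bdd_above (chord_sums g a)"
proof (rule bdd_aboveI)
  fix S assume "S \<in> chord_sums g a"
  from chord_sums_le[OF this assms] show "S \<le> enn2real (curve_length g)"
    using zero_le_dist[of "g 0" "g a"] by linarith
qed

text \<open>
  The rest of a curve is shorter than the whole at least by the chord that has been passed: this
  and the next lemma are the parts of additivity of length that the estimates below rely on.
\<close>
lemma length_from_le:
  assumes "0 \<le> a" "a \<le> 1"
  shows "dist (g 0) (g a) + length_from g a \<le> enn2real (curve_length g)"
proof -
  have "length_from g a \<le> enn2real (curve_length g) - dist (g 0) (g a)"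
    unfolding length_from_def
    using chord_sums_le[OF _ assms(1)] chord_sums_nonempty[OF assms(2)]
    by (intro cSup_least) (force simp: algebra_simps)+
  then show ?thesis by simp
qed

lemma dist_le_length_from_diff:
  assumes "0 \<le> a" "a \<le> b" "b \<le> 1"
  shows "dist (g a) (g b) \<le> length_from g a - length_from g b"
proof -
  have "length_from g b \<le> length_from g a - dist (g a) (g b)"
    unfolding length_from_def[of g b]
  proof (rule cSup_least[OF chord_sums_nonempty[OF assms(3)]])
    fix S assume "S \<in> chord_sums g b"
    then have "dist (g a) (g b) + S \<le> length_from g a"
      unfolding length_from_def
      using chord_sums_prepend assms bdd_above_chord_sums by (intro cSup_upper) auto
    then show "S \<le> length_from g a - dist (g a) (g b)" by simp
  qed
  then show ?thesis by simp
qed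

lemma length_from_end_nonneg: "0 \<le> length_from g 1"
proof -
  have "0 \<in> chord_sums g 1"
    unfolding chord_sums_def by (auto intro!: exI[of _ "0::nat"] exI[of _ "\<lambda>_. 1"])
  then show ?thesis
    unfolding length_from_def using bdd_above_chord_sums by (intro cSup_upper) auto
qed

end

lemma intrinsic_dist_shortest_arc:
  assumes "shortest_arc M P R g"
  shows "intrinsic_dist M P R = enn2real (curve_length g)"
proof -
  have "(INF h\<in>curves_on M P R. curve_length h) = curve_length g"
    using assms unfolding shortest_arc_def by (intro antisym INF_lower INF_greatest) auto
  then show ?thesis by (simp add: intrinsic_dist_def)
qed

text \<open>
  Leaving \<open>X\<close> along \<open>h\<close>, joining the shortest arc from \<open>P\<close> to \<open>R\<close> at \<open>g s\<close>, and following it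
  to the end saves the piece of the arc before \<open>g s\<close>, which is at least as long as its chord.
\<close>
lemma intrinsic_dist_detour:
  assumes g: "shortest_arc M P R g" and s: "0 \<le> s" "s \<le> 1"
    and h: "h \<in> curves_on M X (g s)" and G: "length_controlled h G"
  shows "intrinsic_dist M X R \<le> intrinsic_dist M P R + (G 1 - G 0) - dist P (g s)"
proof -
  have g': "path g" "path_image g \<subseteq> M" "g 0 = P" "g 1 = R" and fin: "curve_length g < top"
    using g unfolding shortest_arc_def curves_on_def pathstart_def pathfinish_def by auto
  have h': "path h" "path_image h \<subseteq> M" "h 0 = X" "h 1 = g s"
    using h unfolding curves_on_def pathstart_def pathfinish_def by auto
  define k where "k = h +++ subpath s 1 g"
  define L where "L = length_from g"
  define \<tau> where "\<tau> = (\<lambda>t. s + (1 - s) * (2 * t - 1))"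
  \<comment> \<open>Negative remaining length on the second half, so that only differences of \<open>L\<close> occur.\<close>
  define H where "H = (\<lambda>t. if t \<le> 1/2 then G (2 * t) - G 1 - L s else - L (\<tau> t))"
  have k_le: "k t = h (2 * t)" if "t \<le> 1/2" for t
    using that by (simp add: k_def joinpaths_def)
  have k_gt: "k t = g (\<tau> t)" if "\<not> t \<le> 1/2" for t
    using that by (simp add: k_def joinpaths_def subpath_def \<tau>_def algebra_simps)
  have \<tau>: "s \<le> \<tau> a \<and> \<tau> a \<le> \<tau> b \<and> \<tau> b \<le> 1" if "1/2 \<le> a" "a \<le> b" "b \<le> 1" for a b
  proof (intro conjI)
    show "s \<le> \<tau> a" using that s by (simp add: \<tau>_def)
    show "\<tau> a \<le> \<tau> b" using that s by (auto simp: \<tau>_def intro!: mult_left_mono)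
    have "(1 - s) * (2 * b - 1) \<le> (1 - s) * 1" using that s by (intro mult_left_mono) auto
    then show "\<tau> b \<le> 1" by (simp add: \<tau>_def)
  qed
  have k: "k \<in> curves_on M X R"
  proof -
    have "path (subpath s 1 g)" "path_image (subpath s 1 g) \<subseteq> M"
      using g' s path_image_subpath_subset[of s 1 g] by (auto intro!: path_subpath)
    moreover have "pathfinish h = pathstart (subpath s 1 g)"
      using h' by (simp add: pathfinish_def)
    ultimately show ?thesis
      using h' g' unfolding k_def curves_on_def
      by (auto simp: path_image_join) (auto simp: pathstart_def pathfinish_def)
  qed
  have "length_controlled k H"
    unfolding length_controlled_def
  proof (intro allI impI, elim conjE)
    fix a b :: real assume ab: "0 \<le> a" "a \<le> b" "b \<le> 1"
    consider "b \<le> 1/2" | "a \<le> 1/2" "\<not> b \<le> 1/2" | "\<not> a \<le> 1/2" using ab by linarith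
    then show "dist (k a) (k b) \<le> H b - H a"
    proof cases
      case 1
      then show ?thesis using ab G by (simp add: k_le H_def length_controlled_def)
    next
      case 2
      have "dist (h (2 * a)) (h 1) \<le> G 1 - G (2 * a)"
        using 2 ab G by (simp add: length_controlled_def)
      moreover have "dist (g s) (g (\<tau> b)) \<le> L s - L (\<tau> b)"
        unfolding L_def using dist_le_length_from_diff[OF fin, of s "\<tau> b"] \<tau>[of b b] s 2 ab by auto
      ultimately show ?thesis
        using 2 h' dist_triangle[of "h (2 * a)" "g (\<tau> b)" "g s"] by (simp add: k_le k_gt H_def)
    next
      case 3
      then show ?thesis
        using ab \<tau>[of a b] s dist_le_length_from_diff[OF fin, of "\<tau> a" "\<tau> b"]
        by (simp add: k_gt H_def L_def)
    qed
  qed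
  from curve_length_le_control[OF this]
  have "curve_length k \<le> ennreal (H 1 - H 0)" .
  also have "\<dots> \<le> ennreal (enn2real (curve_length g) + (G 1 - G 0) - dist P (g s))"
    using length_from_le[OF fin s] length_from_end_nonneg[OF fin] g'
    by (intro ennreal_leI) (simp add: H_def L_def \<tau>_def)
  finally have "(INF k\<in>curves_on M X R. curve_length k)
      \<le> ennreal (enn2real (curve_length g) + (G 1 - G 0) - dist P (g s))"
    using k by (meson INF_lower2)
  moreover have "0 \<le> enn2real (curve_length g) + (G 1 - G 0) - dist P (g s)"
  proof -
    have "0 \<le> length_from g s"
      using dist_le_length_from_diff[OF fin, of s 1] length_from_end_nonneg[OF fin] s
        zero_le_dist[of "g s" "g 1"] by linarith
    moreover have "0 \<le> G 1 - G 0"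
      using G[unfolded length_controlled_def, rule_format, of 0 1] zero_le_dist[of "h 0" "h 1"]
      by linarith
    ultimately show ?thesis
      using length_from_le[OF fin s] g' by simp
  qed
  ultimately show ?thesis
    unfolding intrinsic_dist_shortest_arc[OF g] by (simp add: intrinsic_dist_def enn2real_leI)
qed

section \<open>The surface as a graph over a supporting plane\<close>

text \<open>
  A convex body with a supporting plane at \<open>P\<close>, normal to \<open>\<nu>\<close>, and a ball inside the body.
  The body is viewed along the direction \<open>n = P - e\<close> from the centre of the ball to \<open>P\<close>. The
  direction \<open>\<nu>\<close> itself would not do: if the body has an edge at \<open>P\<close>, it may be bounded by a
  face parallel to \<open>\<nu>\<close>, and then it is not a graph over the supporting plane.
\<close>
locale roofed_body =
  fixes B :: "(real^3) set" and P e \<nu> :: "real^3" and r :: real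
  assumes convex: "convex B" and closed: "closed B"
    and P: "P \<in> B" and ball: "ball e r \<subseteq> B"
    and support: "\<And>x. x \<in> B \<Longrightarrow> \<nu> \<bullet> (x - P) \<le> 0"
    and descent: "\<nu> \<bullet> (e - P) < 0"
begin

abbreviation n :: "real^3" where "n \<equiv> P - e"

definition roof :: "real^3 \<Rightarrow> real" where
  "roof x = Sup {h. x + h *\<^sub>R n \<in> B}"

lemma slope_pos: "0 < \<nu> \<bullet> n"
  using descent by (simp add: inner_diff_right)

lemma height_le:
  assumes "x + h *\<^sub>R n \<in> B"
  shows "h \<le> - (\<nu> \<bullet> (x - P)) / (\<nu> \<bullet> n)"
  using support[OF assms] slope_pos by (simp add: field_simps inner_simps)

text \<open>
  The translation by \<open>- n\<close> carries the ball around \<open>P\<close> into the ball inside the body. Hence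
  every line parallel to \<open>n\<close> through a point near \<open>P\<close> starts inside the body and leaves it
  exactly once.
\<close>
lemma below_interior:
  assumes "x \<in> ball P r" shows "x - n \<in> interior B"
proof -
  have "x - n \<in> ball e r"
    using assms by (simp add: dist_norm algebra_simps)
  then show ?thesis using ball interior_maximal open_ball by blast
qed

lemma le_roof:
  assumes "x + h *\<^sub>R n \<in> B" shows "h \<le> roof x"
  unfolding roof_def using assms height_le by (intro cSup_upper bdd_aboveI) auto

lemma roof_mem:
  assumes "x \<in> ball P r" shows "x + roof x *\<^sub>R n \<in> B"
proof -
  let ?H = "{h. x + h *\<^sub>R n \<in> B}"
  have "x - n \<in> B" using below_interior[OF assms] interior_subset by blast
  then have "- 1 \<in> ?H" by (simp add: algebra_simps)
  moreover have "bdd_above ?H"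
    by (rule bdd_aboveI[of _ "- (\<nu> \<bullet> (x - P)) / (\<nu> \<bullet> n)"]) (use height_le in blast)
  moreover have "closed ?H"
  proof -
    have "?H = (\<lambda>h. x + h *\<^sub>R n) -` B" by auto
    then show ?thesis by (auto intro!: continuous_closed_vimage closed continuous_intros)
  qed
  ultimately show ?thesis using closed_contains_Sup[of ?H] unfolding roof_def by blast
qed

lemma roof_frontier:
  assumes "x \<in> ball P r" shows "x + roof x *\<^sub>R n \<in> frontier B"
proof -
  let ?y = "x + roof x *\<^sub>R n"
  have "?y \<notin> interior B"
  proof
    assume "?y \<in> interior B"
    then obtain d where d: "d > 0" "cball ?y d \<subseteq> B" by (auto simp: mem_interior_cball)
    have n0: "n \<noteq> 0" using slope_pos by auto
    define \<delta> where "\<delta> = d / norm n"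
    have "dist ?y (x + (roof x + \<delta>) *\<^sub>R n) = d"
      using d(1) n0 by (simp add: dist_norm \<delta>_def scaleR_left_distrib)
    then have "x + (roof x + \<delta>) *\<^sub>R n \<in> B" using d(2) by auto
    from le_roof[OF this] have "\<delta> \<le> 0" by simp
    then show False using d(1) n0 by (simp add: \<delta>_def divide_le_0_iff)
  qed
  then show ?thesis
    using roof_mem[OF assms] closed by (simp add: frontier_def)
qed

text \<open>
  A boundary point with further points of the body above it would lie strictly between an interior
  point and a point of the body, and would be interior. So the roof is the whole boundary near \<open>P\<close>.
\<close>
lemma roof_eq_0:
  assumes "x \<in> ball P r" and "x \<in> frontier B"
  shows "roof x = 0"
proof -
  have "x \<in> B" using assms(2) closed by (simp add: frontier_def)
  then have "0 \<le> roof x" by (intro le_roof) simp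
  moreover have "\<not> 0 < roof x"
  proof
    assume pos: "0 < roof x"
    define q where "q = roof x / (1 + roof x)"
    have "(x + roof x *\<^sub>R n) - q *\<^sub>R ((x + roof x *\<^sub>R n) - (x - n)) \<in> interior B"
      using pos
      by (intro mem_interior_convex_shrink convex below_interior roof_mem assms) (auto simp: q_def)
    moreover have "(x + roof x *\<^sub>R n) - q *\<^sub>R ((x + roof x *\<^sub>R n) - (x - n))
        = x + (roof x - q * (1 + roof x)) *\<^sub>R n"
      by (simp add: algebra_simps)
    moreover have "roof x - q * (1 + roof x) = 0"
      using pos by (simp add: q_def)
    ultimately show False using assms(2) by (simp add: frontier_def)
  qed
  ultimately show ?thesis by linarith
qed

lemma roof_concave: "convex_on (ball P r) (\<lambda>x. - roof x)"
  unfolding convex_on_def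
proof (intro conjI ballI allI impI)
  fix x y :: "real^3" and u v :: real
  assume xy: "x \<in> ball P r" "y \<in> ball P r" and uv: "0 \<le> u" "0 \<le> v" "u + v = 1"
  have "u *\<^sub>R (x + roof x *\<^sub>R n) + v *\<^sub>R (y + roof y *\<^sub>R n) \<in> B"
    using convexD[OF convex] roof_mem xy uv by blast
  moreover have "u *\<^sub>R (x + roof x *\<^sub>R n) + v *\<^sub>R (y + roof y *\<^sub>R n)
      = (u *\<^sub>R x + v *\<^sub>R y) + (u * roof x + v * roof y) *\<^sub>R n"
    by (simp add: algebra_simps)
  ultimately have "u * roof x + v * roof y \<le> roof (u *\<^sub>R x + v *\<^sub>R y)"
    using le_roof by metis
  then show "- roof (u *\<^sub>R x + v *\<^sub>R y) \<le> u * - roof x + v * - roof y" by simp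
qed simp

lemma roof_continuous: "continuous_on (ball P r) roof"
  using continuous_on_minus[OF convex_on_continuous[OF open_ball roof_concave]] by simp

end

text \<open>
  A function that first rises and then falls has total variation at most twice its range. The
  control function is, apart from the constant \<open>f 0\<close>, the variation up to \<open>a\<close>: on the left of the maximum point \<open>p\<close>
  it is \<open>f a\<close>, on the right \<open>2 f p - f a\<close>.
\<close>
lemma quasiconcave_length_control:
  fixes f :: "real \<Rightarrow> real"
  assumes cont: "continuous_on {0..1} f"
    and quasi: "\<And>a b c. \<lbrakk>0 \<le> a; a \<le> b; b \<le> c; c \<le> 1\<rbrakk> \<Longrightarrow> min (f a) (f c) \<le> f b"
    and range: "\<And>a. \<lbrakk>0 \<le> a; a \<le> 1\<rbrakk> \<Longrightarrow> 0 \<le> f a \<and> f a \<le> m"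
  obtains G where "G 1 - G 0 \<le> 2 * m"
    and "\<And>a b. \<lbrakk>0 \<le> a; a \<le> b; b \<le> 1\<rbrakk> \<Longrightarrow> \<bar>f b - f a\<bar> \<le> G b - G a"
proof -
  obtain p where p: "0 \<le> p" "p \<le> 1" and max: "\<And>a. \<lbrakk>0 \<le> a; a \<le> 1\<rbrakk> \<Longrightarrow> f a \<le> f p"
    using continuous_attains_sup[OF _ _ cont] by auto
  have up: "f a \<le> f b" if "0 \<le> a" "a \<le> b" "b \<le> p" for a b
    using quasi[of a b p] max[of a] that p by auto
  have down: "f b \<le> f a" if "p \<le> a" "a \<le> b" "b \<le> 1" for a b
    using quasi[of p a b] max[of b] that p by auto
  define G where "G = (\<lambda>a. 2 * f (min a p) - f a)"
  show thesis
  proof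
    show "G 1 - G 0 \<le> 2 * m"
      using p range[of p] range[of 0] range[of 1] by (simp add: G_def)
    fix a b :: real assume ab: "0 \<le> a" "a \<le> b" "b \<le> 1"
    consider "b \<le> p" | "p \<le> a" | "a \<le> p" "p \<le> b" using ab by linarith
    then show "\<bar>f b - f a\<bar> \<le> G b - G a"
    proof cases
      case 1 then show ?thesis using up[of a b] ab by (simp add: G_def min_def)
    next
      case 2 then show ?thesis using down[of a b] ab by (auto simp add: G_def min_def)
    next
      case 3 then show ?thesis using max[of a] max[of b] ab by (auto simp add: G_def min_def)
    qed
  qed
qed

context roofed_body
begin

text \<open>
  The curve is the part of the roof above the segment from \<open>Z\<close> to \<open>Y\<close>. Where the segment is at
  most \<open>\<eta>\<close> below the supporting plane, the roof can rise by at most \<open>\<eta> / (\<nu> \<bullet> n)\<close> over it, since it stays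
  below that plane. It ends at \<open>Y\<close> because \<open>Y\<close> is on the boundary. The starting point depends
  on \<open>Z\<close> alone, so one point \<open>X\<close> serves for all vertices.
\<close>
lemma short_curve_on_frontier:
  assumes Z: "Z \<in> B" "Z \<in> ball P r" "- \<eta> \<le> \<nu> \<bullet> (Z - P)"
    and Y: "Y \<in> frontier B" "Y \<in> ball P r" "- \<eta> \<le> \<nu> \<bullet> (Y - P)"
  obtains h G where "h \<in> curves_on (frontier B) (Z + roof Z *\<^sub>R n) Y" "length_controlled h G"
    "G 1 - G 0 \<le> norm (Y - Z) + 2 * norm n * (\<eta> / (\<nu> \<bullet> n))"
proof -
  define x where "x = (\<lambda>l. Z + l *\<^sub>R (Y - Z))"
  define f where "f = (\<lambda>l. roof (x l))"
  define h where "h = (\<lambda>l. x l + f l *\<^sub>R n)"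
  have YB: "Y \<in> B" using Y(1) closed by (simp add: frontier_def)
  have x_conv: "x ((1 - l) * a + l * c) = (1 - l) *\<^sub>R x a + l *\<^sub>R x c" for l a c
    by (simp add: x_def algebra_simps)
  have x_eq: "x l = (1 - l) *\<^sub>R Z + l *\<^sub>R Y" for l
    by (simp add: x_def algebra_simps)
  have x_ball: "x l \<in> ball P r" and x_B: "x l \<in> B" if "0 \<le> l" "l \<le> 1" for l
    unfolding x_eq using that convexD[OF convex_ball Z(2) Y(2)] convexD[OF convex Z(1) YB] by auto
  have cont: "continuous_on {0..1} f"
    unfolding f_def using x_ball
    by (intro continuous_on_compose2[OF roof_continuous]) (auto simp: x_def intro!: continuous_intros)
  have quasi: "min (f a) (f c) \<le> f b" if abc: "0 \<le> a" "a \<le> b" "b \<le> c" "c \<le> 1" for a b c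
  proof -
    obtain l where l: "0 \<le> l" "l \<le> 1" "b = (1 - l) * a + l * c"
    proof -
      have "b \<in> closed_segment a c" using abc by (simp add: closed_segment_eq_real_ivl)
      then show ?thesis using that unfolding closed_segment_def by auto
    qed
    have "- f b \<le> (1 - l) * - f a + l * - f c"
      unfolding f_def l(3) x_conv
      using roof_concave l x_ball[of a] x_ball[of c] abc unfolding convex_on_def by auto
    moreover have "(1 - l) * min (f a) (f c) + l * min (f a) (f c) \<le> (1 - l) * f a + l * f c"
      using l by (intro add_mono mult_left_mono) auto
    ultimately show ?thesis by (simp add: algebra_simps)
  qed
  have range: "0 \<le> f a \<and> f a \<le> \<eta> / (\<nu> \<bullet> n)" if a: "0 \<le> a" "a \<le> 1" for a
  proof
    show "0 \<le> f a" unfolding f_def using x_B[OF a] by (intro le_roof) simp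
    have "\<nu> \<bullet> (x a - P) = (1 - a) * (\<nu> \<bullet> (Z - P)) + a * (\<nu> \<bullet> (Y - P))"
      by (simp add: x_eq inner_simps algebra_simps)
    also have "\<dots> \<ge> (1 - a) * - \<eta> + a * - \<eta>"
      using a Z(3) Y(3) by (intro add_mono mult_left_mono) auto
    finally have "- (\<nu> \<bullet> (x a - P)) \<le> \<eta>" by (simp add: algebra_simps)
    then have "- (\<nu> \<bullet> (x a - P)) / (\<nu> \<bullet> n) \<le> \<eta> / (\<nu> \<bullet> n)"
      using slope_pos by (intro divide_right_mono) auto
    with height_le[OF roof_mem[OF x_ball[OF a]]] show "f a \<le> \<eta> / (\<nu> \<bullet> n)"
      by (simp add: f_def)
  qed
  obtain G where G: "G 1 - G 0 \<le> 2 * (\<eta> / (\<nu> \<bullet> n))"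
    "\<And>a b. \<lbrakk>0 \<le> a; a \<le> b; b \<le> 1\<rbrakk> \<Longrightarrow> \<bar>f b - f a\<bar> \<le> G b - G a"
    using quasiconcave_length_control[of f "\<eta> / (\<nu> \<bullet> n)"] cont quasi range by blast
  define G' where "G' = (\<lambda>a. a * norm (Y - Z) + norm n * G a)"
  show thesis
  proof
    have "path h"
      unfolding path_def h_def x_def using cont by (intro continuous_intros)
    moreover have "path_image h \<subseteq> frontier B"
      using roof_frontier x_ball by (auto simp: path_image_def h_def f_def)
    ultimately show "h \<in> curves_on (frontier B) (Z + roof Z *\<^sub>R n) Y"
      using roof_eq_0[OF Y(2,1)]
      by (simp add: curves_on_def pathstart_def pathfinish_def h_def f_def x_def)
    show "length_controlled h G'"
      unfolding length_controlled_def
    proof (intro allI impI, elim conjE)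
      fix a b :: real assume ab: "0 \<le> a" "a \<le> b" "b \<le> 1"
      have "h b - h a = (b - a) *\<^sub>R (Y - Z) + (f b - f a) *\<^sub>R n"
        by (simp add: h_def x_def algebra_simps)
      then have "dist (h a) (h b) = norm ((b - a) *\<^sub>R (Y - Z) + (f b - f a) *\<^sub>R n)"
        by (metis dist_norm dist_commute)
      also have "\<dots> \<le> (b - a) * norm (Y - Z) + \<bar>f b - f a\<bar> * norm n"
        using norm_triangle_ineq[of "(b - a) *\<^sub>R (Y - Z)" "(f b - f a) *\<^sub>R n"] ab by simp
      also have "\<dots> \<le> (b - a) * norm (Y - Z) + (G b - G a) * norm n"
        using G(2)[OF ab] by (intro add_left_mono mult_right_mono) auto
      finally show "dist (h a) (h b) \<le> G' b - G' a"
        by (simp add: G'_def algebra_simps)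
    qed
    have "norm n * (G 1 - G 0) \<le> norm n * (2 * (\<eta> / (\<nu> \<bullet> n)))"
      using G(1) by (intro mult_left_mono) auto
    then show "G' 1 - G' 0 \<le> norm (Y - Z) + 2 * norm n * (\<eta> / (\<nu> \<bullet> n))"
      by (simp add: G'_def algebra_simps)
  qed
qed

end

section \<open>Directions of arcs on the boundary of a convex body\<close>

lemma norm_initial_direction:
  assumes "arc g" and "initial_direction g u"
  shows "norm u = 1"
proof -
  have "((\<lambda>t. norm (sgn (g t - g 0))) \<longlongrightarrow> norm u) (at_right 0)"
    using assms(2) unfolding initial_direction_def by (rule tendsto_norm)
  moreover have "\<forall>\<^sub>F t in at_right 0. norm (sgn (g t - g 0)) = 1"
  proof -
    have "\<forall>\<^sub>F t in at_right (0::real). 0 < t \<and> t < 1"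
      by (rule eventually_at_rightI[of 0 1]) auto
    then show ?thesis
    proof eventually_elim
      case (elim t)
      then have "g t \<noteq> g 0"
        using arcD[OF assms(1), of t 0] by auto
      then show ?case by (simp add: norm_sgn)
    qed
  qed
  ultimately have "((\<lambda>_. 1) \<longlongrightarrow> norm u) (at_right (0::real))"
    by (rule Lim_transform_eventually)
  then show ?thesis
    using tendsto_unique[OF trivial_limit_at_right_real] tendsto_const by blast
qed

text \<open>
  Arcs come with arbitrary parametrizations. This lemma replaces the parameter by the distance from
  the starting point, so that points on several arcs can be compared at the same scale \<open>t\<close>.
\<close>
lemma eventually_arc_point_at_distance:
  assumes g: "arc g" "initial_direction g u" and "0 < \<epsilon>"
  shows "\<forall>\<^sub>F t in at_right 0. \<exists>s. 0 \<le> s \<and> s \<le> 1 \<and> dist (g 0) (g s) = t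
           \<and> norm (g s - g 0 - t *\<^sub>R u) \<le> \<epsilon> * t"
proof -
  have "\<forall>\<^sub>F s in at_right 0. dist (sgn (g s - g 0)) u < \<epsilon>"
    using assms(2,3) unfolding initial_direction_def by (rule tendstoD)
  then obtain b where b: "0 < b" "\<And>s. \<lbrakk>0 < s; s < b\<rbrakk> \<Longrightarrow> dist (sgn (g s - g 0)) u < \<epsilon>"
    by (auto simp: eventually_at_right_field)
  define a where "a = min (b / 2) 1"
  have a: "0 < a" "a < b" "a \<le> 1" using b(1) by (auto simp: a_def)
  have cont: "continuous_on {0..a} (\<lambda>s. dist (g 0) (g s))"
  proof -
    have "continuous_on {0..1} g" using g(1) by (simp add: arc_def path_def)
    then have "continuous_on {0..a} g" by (rule continuous_on_subset) (use a in auto)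
    then show ?thesis by (intro continuous_intros)
  qed
  have pos: "0 < dist (g 0) (g a)"
    using arcD[OF g(1), of 0 a] a by auto
  have "\<exists>s. 0 \<le> s \<and> s \<le> 1 \<and> dist (g 0) (g s) = t \<and> norm (g s - g 0 - t *\<^sub>R u) \<le> \<epsilon> * t"
    if t: "0 < t" "t < dist (g 0) (g a)" for t
  proof -
    obtain s where s: "0 \<le> s" "s \<le> a" "dist (g 0) (g s) = t"
      using IVT'[of "\<lambda>s. dist (g 0) (g s)" 0 t a] cont t a by auto
    with t have "0 < s" by (cases "s = 0") auto
    have nt: "norm (g s - g 0) = t" using s(3) by (simp add: dist_norm norm_minus_commute)
    have "t *\<^sub>R sgn (g s - g 0) = g s - g 0"
      using t nt by (simp add: sgn_div_norm)
    then have "norm (g s - g 0 - t *\<^sub>R u) = t * dist (sgn (g s - g 0)) u"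
      using t by (metis abs_of_pos dist_norm norm_scaleR scaleR_right_diff_distrib)
    also have "\<dots> \<le> t * \<epsilon>"
      using b(2)[of s] \<open>0 < s\<close> s a t by (intro mult_left_mono) auto
    finally show ?thesis using s a by (auto simp: mult.commute)
  qed
  with pos show ?thesis
    by (intro eventually_at_rightI[of 0 "dist (g 0) (g a)"]) auto
qed

text \<open>
  The closure of this set is the tangent cone of a convex body \<open>B\<close> at \<open>P\<close>, and the feasible
  directions of the interior of \<open>B\<close> are the inner points of that cone.
\<close>
definition feasible_directions :: "(real^3) set \<Rightarrow> real^3 \<Rightarrow> (real^3) set" where
  "feasible_directions B P = {y. \<exists>l>0. P + l *\<^sub>R y \<in> B}"

lemma initial_direction_in_closure:
  assumes g: "arc g" "initial_direction g u" and B: "path_image g \<subseteq> B"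
  shows "u \<in> closure (feasible_directions B (g 0))"
proof (rule iffD2[OF closure_approachable], intro allI impI)
  fix \<epsilon> :: real assume "0 < \<epsilon>"
  have "\<forall>\<^sub>F t in at_right (0::real). 0 < t"
    by (rule eventually_at_right_less)
  moreover have "\<forall>\<^sub>F t in at_right 0. \<exists>s. 0 \<le> s \<and> s \<le> 1 \<and> dist (g 0) (g s) = t
           \<and> norm (g s - g 0 - t *\<^sub>R u) \<le> \<epsilon> / 2 * t"
    using eventually_arc_point_at_distance[OF g] \<open>0 < \<epsilon>\<close> half_gt_zero by blast
  ultimately have "\<forall>\<^sub>F t in at_right 0. 0 < t \<and> (\<exists>s. 0 \<le> s \<and> s \<le> 1 \<and> dist (g 0) (g s) = t
           \<and> norm (g s - g 0 - t *\<^sub>R u) \<le> \<epsilon> / 2 * t)"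
    by (rule eventually_conj)
  then obtain t s where t: "0 < t" and s: "0 \<le> s" "s \<le> 1"
      and le: "norm (g s - g 0 - t *\<^sub>R u) \<le> \<epsilon> / 2 * t"
    by (auto dest!: eventually_happens'[OF trivial_limit_at_right_real])
  define y where "y = (1 / t) *\<^sub>R (g s - g 0)"
  have "g 0 + t *\<^sub>R y = g s" using t by (simp add: y_def)
  then have "y \<in> feasible_directions B (g 0)"
    using t s B unfolding feasible_directions_def path_image_def by force
  moreover have "dist y u < \<epsilon>"
  proof -
    have "y - u = (1 / t) *\<^sub>R (g s - g 0 - t *\<^sub>R u)"
      using t by (simp add: y_def algebra_simps)
    then have "dist y u = (1 / t) * norm (g s - g 0 - t *\<^sub>R u)"
      using t by (simp add: dist_norm)
    also have "\<dots> \<le> (1 / t) * (\<epsilon> / 2 * t)"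
      using le t by (intro mult_left_mono) auto
    finally have "dist y u \<le> \<epsilon> / 2" using t by simp
    then show ?thesis using \<open>0 < \<epsilon>\<close> by linarith
  qed
  ultimately show "\<exists>y\<in>feasible_directions B (g 0). dist y u < \<epsilon>" by blast
qed

lemma feasible_interior_shrink:
  fixes P :: "real^3"
  assumes "convex B" "P \<in> B" "P + l *\<^sub>R y \<in> interior B" "0 < m" "m \<le> l"
  shows "P + m *\<^sub>R y \<in> interior B"
proof -
  have "P - (m / l) *\<^sub>R (P - (P + l *\<^sub>R y)) \<in> interior B"
    using assms by (intro mem_interior_convex_shrink) auto
  moreover have "P - (m / l) *\<^sub>R (P - (P + l *\<^sub>R y)) = P + m *\<^sub>R y"
    using less_le_trans[OF assms(4,5)] by simp
  ultimately show ?thesis by (simp only:)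
qed

text \<open>
  Along a direction that enters the interior, a whole narrow cone of nearby segments runs inside the
  body, and a curve with that initial direction would have to enter this cone.
\<close>
lemma initial_direction_not_interior:
  assumes B: "convex B" "closed B" and g: "arc g" "initial_direction g u"
    and M: "path_image g \<subseteq> frontier B"
  shows "u \<notin> feasible_directions (interior B) (g 0)"
proof
  assume "u \<in> feasible_directions (interior B) (g 0)"
  then obtain l where l: "0 < l" "g 0 + l *\<^sub>R u \<in> interior B"
    by (auto simp: feasible_directions_def)
  then obtain d where d: "0 < d" "ball (g 0 + l *\<^sub>R u) d \<subseteq> interior B"
    using open_contains_ball[of "interior B"] by auto
  \<comment> \<open>With this error the direction of the chord is so close to \<open>u\<close> that, prolonged to \<open>l\<close>, it
    ends in the ball.\<close>
  have "0 < d / (2 * l)" using d l by simp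
  from eventually_arc_point_at_distance[OF g this]
  have ev: "\<forall>\<^sub>F t in at_right 0. \<exists>s. 0 \<le> s \<and> s \<le> 1 \<and> dist (g 0) (g s) = t
           \<and> norm (g s - g 0 - t *\<^sub>R u) \<le> d / (2 * l) * t" .
  have "\<forall>\<^sub>F t in at_right (0::real). 0 < t \<and> t < l"
    using l by (intro eventually_at_rightI[of 0 l]) auto
  with ev have "\<forall>\<^sub>F t in at_right 0. (\<exists>s. 0 \<le> s \<and> s \<le> 1 \<and> dist (g 0) (g s) = t
           \<and> norm (g s - g 0 - t *\<^sub>R u) \<le> d / (2 * l) * t) \<and> 0 < t \<and> t < l"
    by (rule eventually_conj)
  then obtain t s where t: "0 < t" "t < l" and s: "0 \<le> s" "s \<le> 1"
      and le: "norm (g s - g 0 - t *\<^sub>R u) \<le> d / (2 * l) * t"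
    by (auto dest!: eventually_happens'[OF trivial_limit_at_right_real])
  define y where "y = (1 / t) *\<^sub>R (g s - g 0)"
  have gs: "g 0 + t *\<^sub>R y = g s" using t by (simp add: y_def)
  have frontier: "g 0 \<in> frontier B" "g s \<in> frontier B"
    using M s unfolding path_image_def by auto
  have "(g 0 + l *\<^sub>R u) - (g 0 + l *\<^sub>R y) = (l / t) *\<^sub>R (t *\<^sub>R u - (g s - g 0))"
    using t by (simp add: y_def algebra_simps)
  then have "dist (g 0 + l *\<^sub>R u) (g 0 + l *\<^sub>R y) = norm ((l / t) *\<^sub>R (t *\<^sub>R u - (g s - g 0)))"
    by (simp only: dist_norm)
  also have "\<dots> = (l / t) * norm (g s - g 0 - t *\<^sub>R u)"
    using t l by (simp add: norm_minus_commute)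
  also have "\<dots> \<le> (l / t) * (d / (2 * l) * t)"
    using le t l by (intro mult_left_mono) auto
  also have "\<dots> < d" using t l d by simp
  finally have "g 0 + l *\<^sub>R y \<in> interior B" using d by auto
  moreover have "g 0 \<in> B" using frontier(1) B(2) by (simp add: frontier_def)
  ultimately have "g s \<in> interior B"
    using feasible_interior_shrink[OF B(1), of "g 0" l y t] t gs by simp
  with frontier(2) show False by (simp add: frontier_def)
qed

lemma open_feasible_interior: "open (feasible_directions (interior B) P)"
proof -
  have "feasible_directions (interior B) P = (\<Union>l\<in>{0<..}. (\<lambda>y. P + l *\<^sub>R y) -` interior B)"
    by (auto simp: feasible_directions_def)
  moreover have "open ((\<lambda>y. P + l *\<^sub>R y) -` interior B)" for l
    by (intro continuous_open_vimage continuous_intros open_interior)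
  ultimately show ?thesis by (simp add: open_UN)
qed

lemma feasible_directions_scale:
  assumes "x \<in> feasible_directions B P" "0 < a"
  shows "a *\<^sub>R x \<in> feasible_directions B P"
proof -
  obtain l where "0 < l" "P + l *\<^sub>R x \<in> B" using assms by (auto simp: feasible_directions_def)
  then have "0 < l / a" "P + (l / a) *\<^sub>R (a *\<^sub>R x) \<in> B" using assms by auto
  then show ?thesis unfolding feasible_directions_def by blast
qed

lemma feasible_interior_add:
  assumes B: "convex B" and x: "x \<in> feasible_directions (interior B) P"
    and y: "y \<in> feasible_directions B P"
  shows "x + y \<in> feasible_directions (interior B) P"
proof -
  obtain l m where l: "0 < l" "P + l *\<^sub>R x \<in> interior B" and m: "0 < m" "P + m *\<^sub>R y \<in> B"
    using x y by (auto simp: feasible_directions_def)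
  define q where "q = m / (l + m)"
  have q: "0 < q" "q \<le> 1" using l m by (auto simp: q_def)
  have "(P + m *\<^sub>R y) - q *\<^sub>R ((P + m *\<^sub>R y) - (P + l *\<^sub>R x)) \<in> interior B"
    using B l m q by (intro mem_interior_convex_shrink) auto
  moreover have "(P + m *\<^sub>R y) - q *\<^sub>R ((P + m *\<^sub>R y) - (P + l *\<^sub>R x)) = P + (q * l) *\<^sub>R (x + y)"
  proof -
    have "(P + m *\<^sub>R y) - q *\<^sub>R ((P + m *\<^sub>R y) - (P + l *\<^sub>R x))
        = P + (q * l) *\<^sub>R x + (m - q * m) *\<^sub>R y"
      by (simp add: algebra_simps)
    also have "m - q * m = q * l" using l m by (simp add: q_def field_simps)
    finally show ?thesis by (simp add: scaleR_right_distrib)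
  qed
  ultimately have "P + (q * l) *\<^sub>R (x + y) \<in> interior B" by (simp only:)
  then show ?thesis using q l unfolding feasible_directions_def by (auto intro!: exI[of _ "q * l"])
qed

text \<open>
  An inner point of a convex cone plus a point of its closure is an inner point: by openness,
  the limit direction \<open>y\<close> can be exchanged for a feasible one at the expense of \<open>x\<close>.
\<close>
lemma feasible_interior_add_closure:
  assumes B: "convex B" and x: "x \<in> feasible_directions (interior B) P"
    and y: "y \<in> closure (feasible_directions B P)" and b: "0 \<le> b"
  shows "x + b *\<^sub>R y \<in> feasible_directions (interior B) P"
proof (cases "b = 0")
  case False
  with b have b: "0 < b" by simp
  obtain d where d: "0 < d" "ball x d \<subseteq> feasible_directions (interior B) P"
    using open_feasible_interior x open_contains_ball by metis
  obtain z where z: "z \<in> feasible_directions B P" "dist z y < d / b"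
    using y b d unfolding closure_approachable by (meson divide_pos_pos)
  have "norm (b *\<^sub>R (z - y)) = b * dist z y" using b by (simp add: dist_norm)
  also have "\<dots> < d" using z(2) b by (simp add: field_simps)
  finally have "x - b *\<^sub>R (z - y) \<in> ball x d" by (simp add: dist_norm)
  then have "(x - b *\<^sub>R (z - y)) + b *\<^sub>R z \<in> feasible_directions (interior B) P"
    using d feasible_interior_add[OF B] feasible_directions_scale[OF z(1) b] by blast
  then show ?thesis by (simp add: algebra_simps)
qed (use x in simp)

text \<open>
  An inner direction in the plane of two boundary directions of the cone lies strictly between them.
  With a nonpositive coefficient, say of \<open>a\<close>, adding the missing multiple of \<open>a\<close> would leave an
  inner direction \<open>q *\<^sub>R b\<close>. Depending on the sign of \<open>q\<close>, then \<open>b\<close> or 0 would be an inner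
  direction.
\<close>
lemma interior_direction_coefficients_pos:
  assumes B: "convex B" and P: "P \<notin> interior B"
    and v: "p *\<^sub>R a + q *\<^sub>R b \<in> feasible_directions (interior B) P"
    and a: "a \<in> closure (feasible_directions B P)" "a \<notin> feasible_directions (interior B) P"
    and b: "b \<in> closure (feasible_directions B P)" "b \<notin> feasible_directions (interior B) P"
  shows "0 < p \<and> 0 < q"
proof -
  let ?I = "feasible_directions (interior B) P"
  have zero: "0 \<notin> ?I" using P by (auto simp: feasible_directions_def)
  have pos: "0 < p'" if v: "p' *\<^sub>R a' + q' *\<^sub>R b' \<in> ?I"
    and a': "a' \<in> closure (feasible_directions B P)"
    and b': "b' \<in> closure (feasible_directions B P)" "b' \<notin> ?I" for p' q' a' b'
  proof (rule ccontr)
    assume "\<not> 0 < p'"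
    from feasible_interior_add_closure[OF B v a', of "- p'"] this
    have "q' *\<^sub>R b' \<in> ?I" by simp
    show False
    proof (cases "0 < q'")
      case True
      from feasible_directions_scale[OF \<open>q' *\<^sub>R b' \<in> ?I\<close>, of "1 / q'"] True b'(2)
      show False by simp
    next
      case False
      with feasible_interior_add_closure[OF B \<open>q' *\<^sub>R b' \<in> ?I\<close> b'(1), of "- q'"] zero
      show False by simp
    qed
  qed
  show ?thesis
    using pos[OF v a(1) b] pos[of q b p a] v a b(1) by (simp add: add.commute)
qed

text \<open>
  Let the plane of \<open>a\<close>, \<open>b\<close>, \<open>c\<close> contain an inner direction \<open>v\<close> of the cone. By the previous
  lemma \<open>v\<close> lies strictly between \<open>a\<close> and \<open>b\<close>, between \<open>a\<close> and \<open>c\<close>, and between \<open>b\<close> and \<open>c\<close>.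
  That is impossible, because two of the three directions are on the same side of the line
  of \<open>v\<close>. So the plane misses the interior and can be separated from it.
\<close>
lemma supporting_plane_through_three_directions:
  assumes B: "convex B" "closed B" "interior B \<noteq> {}" and P: "P \<in> frontier B"
    and a: "a \<in> closure (feasible_directions B P)" "a \<notin> feasible_directions (interior B) P"
    and b: "b \<in> closure (feasible_directions B P)" "b \<notin> feasible_directions (interior B) P"
    and c: "c \<in> closure (feasible_directions B P)" "c \<notin> feasible_directions (interior B) P"
    and comb: "c = x *\<^sub>R a + y *\<^sub>R b" "x \<noteq> 0" "y \<noteq> 0"
  obtains \<nu> where "norm \<nu> = 1" "\<nu> \<bullet> a = 0" "\<nu> \<bullet> b = 0" "\<And>z. z \<in> B \<Longrightarrow> \<nu> \<bullet> (z - P) \<le> 0"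
proof -
  define V where "V = range (\<lambda>(p, q). p *\<^sub>R a + q *\<^sub>R b)"
  have P': "P \<notin> interior B" using P by (simp add: frontier_def)
  have not_interior: "v \<notin> feasible_directions (interior B) P" if "v \<in> V" for v
  proof
    assume v: "v \<in> feasible_directions (interior B) P"
    obtain p q where pq: "v = p *\<^sub>R a + q *\<^sub>R b" using \<open>v \<in> V\<close> by (auto simp: V_def)
    have ac: "v = (p - q * x / y) *\<^sub>R a + (q / y) *\<^sub>R c"
      using comb(2,3) unfolding pq comb(1) by (simp add: algebra_simps)
    have bc: "v = (q - p * y / x) *\<^sub>R b + (p / x) *\<^sub>R c"
      using comb(2,3) unfolding pq comb(1) by (simp add: algebra_simps)
    note pos = interior_direction_coefficients_pos[OF B(1) P']
    have 1: "0 < p" "0 < q" using pos[OF v[unfolded pq] a b] by auto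
    have 2: "0 < p - q * x / y" "0 < q / y" using pos[OF v[unfolded ac] a c] by auto
    have 3: "0 < q - p * y / x" "0 < p / x" using pos[OF v[unfolded bc] b c] by auto
    have "0 < x" "0 < y" using 1 2(2) 3(2) by (auto simp: zero_less_divide_iff)
    then show False using 2(1) 3(1) by (simp add: field_simps)
  qed
  have subspace: "subspace V"
  proof -
    have "linear (\<lambda>(p, q). p *\<^sub>R a + q *\<^sub>R b)"
      by (rule linearI) (auto simp: algebra_simps)
    then show ?thesis unfolding V_def using linear_subspace_image subspace_UNIV by blast
  qed
  have "convex ((+) P ` V)"
    using subspace by (simp add: subspace_imp_convex)
  moreover have "interior B \<inter> (+) P ` V = {}"
  proof -
    have "P + v \<notin> interior B" if "v \<in> V" for v
      using not_interior[OF that] unfolding feasible_directions_def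
      by (auto dest: spec[of _ 1])
    then show ?thesis by auto
  qed
  moreover have "(+) P ` V \<noteq> {}" using subspace subspace_0 by auto
  ultimately obtain m k where m: "m \<noteq> 0" and below': "\<forall>z\<in>interior B. m \<bullet> z \<le> k"
    and above': "\<forall>z\<in>(+) P ` V. k \<le> m \<bullet> z"
    using separating_hyperplane_sets[of "interior B" "(+) P ` V"] B(1,3) convex_interior by metis
  have below: "m \<bullet> z \<le> k" if "z \<in> interior B" for z using below' that by blast
  have above: "k \<le> m \<bullet> (P + v)" if "v \<in> V" for v using above' that by blast
  have kP: "k \<le> m \<bullet> P" using above[of 0] subspace subspace_0 by auto
  have orth: "m \<bullet> v = 0" if v: "v \<in> V" for v
  proof (rule ccontr)
    assume n0: "m \<bullet> v \<noteq> 0"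
    define t where "t = (k - 1 - m \<bullet> P) / (m \<bullet> v)"
    have "t *\<^sub>R v \<in> V" using subspace v subspace_scale by blast
    from above[OF this] have "k \<le> m \<bullet> P + t * (m \<bullet> v)" by (simp add: inner_simps)
    then show False using n0 by (simp add: t_def)
  qed
  have le: "m \<bullet> z \<le> k" if "z \<in> B" for z
  proof -
    have "B = closure (interior B)" using B by (metis closure_closed convex_closure_interior)
    moreover have "closure (interior B) \<subseteq> {z. m \<bullet> z \<le> k}"
      using below by (intro closure_minimal closed_halfspace_le) auto
    ultimately show ?thesis using that by blast
  qed
  have aV: "a \<in> V" unfolding V_def by (rule image_eqI[of _ _ "(1, 0)"]) auto
  have bV: "b \<in> V" unfolding V_def by (rule image_eqI[of _ _ "(0, 1)"]) auto
  show thesis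
  proof (rule that[of "sgn m"])
    show "norm (sgn m) = 1" using m by (simp add: norm_sgn)
    show "sgn m \<bullet> a = 0" "sgn m \<bullet> b = 0" using orth aV bV by (auto simp: sgn_div_norm)
    fix z assume "z \<in> B"
    then have "m \<bullet> z \<le> m \<bullet> P" using le kP by fastforce
    then have "m \<bullet> (z - P) \<le> 0" by (simp add: inner_diff_right)
    then have "inverse (norm m) * (m \<bullet> (z - P)) \<le> 0" by (intro mult_nonneg_nonpos) auto
    then show "sgn m \<bullet> (z - P) \<le> 0" by (simp only: sgn_div_norm inner_scaleR_left)
  qed
qed

section \<open>First-order condition at a minimum\<close>

text \<open>
  This is \<open>sqrt (1 + x) \<le> 1 + x / 2\<close> for \<open>x = |u - V|\<^sup>2 - 1\<close>. The bound has the correct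
  first-order term in \<open>V\<close>, and the weighted sum of the second-order terms is half as large as that
  of the first-order terms when \<open>V\<close> is the weighted mean of the vectors \<open>u\<close>. Therefore \<open>V\<close> itself
  is already a short enough step, in units of \<open>t\<close>.
\<close>
lemma norm_diff_le_first_order:
  fixes u V :: "'a :: real_inner"
  assumes "norm u = 1"
  shows "norm (u - V) \<le> 1 - u \<bullet> V + (norm V)\<^sup>2 / 2"
proof -
  have "(norm (u - V))\<^sup>2 = 1 - 2 * (u \<bullet> V) + (norm V)\<^sup>2"
    using assms by (simp add: power2_norm_eq_inner inner_diff inner_commute flip: norm_eq_1)
  moreover have "0 \<le> (norm (u - V) - 1)\<^sup>2" by simp
  ultimately show ?thesis by (simp add: power2_diff)
qed

text \<open>
  The first-order condition, for any finite number of weighted points whose directions lie in one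
  supporting plane. Moving \<open>P\<close> along the weighted mean of the directions would otherwise lower the
  weighted sum of distances.
\<close>
lemma weighted_directions_balance:
  fixes I :: "'i set" and w :: "'i \<Rightarrow> real" and u R :: "'i \<Rightarrow> real^3" and g :: "'i \<Rightarrow> real \<Rightarrow> real^3"
  assumes B: "convex B" "closed B" "interior B \<noteq> {}"
    and \<nu>: "norm \<nu> = 1" "\<And>z. z \<in> B \<Longrightarrow> \<nu> \<bullet> (z - P) \<le> 0"
    and I: "finite I" and w: "\<And>i. i \<in> I \<Longrightarrow> 0 < w i" "sum w I = c" "0 < c"
    and P: "P \<in> frontier B"
    and min: "\<And>X. X \<in> frontier B \<Longrightarrow>
      (\<Sum>i\<in>I. w i * intrinsic_dist (frontier B) P (R i)) \<le> (\<Sum>i\<in>I. w i * intrinsic_dist (frontier B) X (R i))"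
    and g: "\<And>i. i \<in> I \<Longrightarrow> shortest_arc (frontier B) P (R i) (g i)"
    and u: "\<And>i. i \<in> I \<Longrightarrow> initial_direction (g i) (u i)" "\<And>i. i \<in> I \<Longrightarrow> \<nu> \<bullet> u i = 0"
  shows "(\<Sum>i\<in>I. w i *\<^sub>R u i) = 0"
proof (rule ccontr)
  assume nz: "(\<Sum>i\<in>I. w i *\<^sub>R u i) \<noteq> 0"
  define a where "a = (\<lambda>i. w i / c)"
  have a: "\<forall>i\<in>I. 0 \<le> a i" "sum a I = 1"
    using w by (auto simp: a_def less_imp_le simp flip: sum_divide_distrib)
  define V where "V = (\<Sum>i\<in>I. a i *\<^sub>R u i)"
  have cV: "c *\<^sub>R V = (\<Sum>i\<in>I. w i *\<^sub>R u i)"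
    using w(3) by (simp add: V_def a_def scaleR_sum_right)
  then have "0 < norm V" using nz by auto
  have PB: "P \<in> B" using P B(2) by (simp add: frontier_def)
  obtain e r where r: "0 < r" "ball e r \<subseteq> B"
    using B(3) by (auto simp: mem_interior ex_in_conv[symmetric])
  have descent: "\<nu> \<bullet> (e - P) < 0"
  proof -
    have "e + (r / 2) *\<^sub>R \<nu> \<in> B" using r \<nu>(1) by (intro subsetD[OF r(2)]) (simp add: dist_norm)
    from \<nu>(2)[OF this] have "\<nu> \<bullet> (e - P) + r / 2 \<le> 0"
      using iffD1[OF norm_eq_1 \<nu>(1)] by (simp add: inner_simps)
    then show ?thesis using r(1) by linarith
  qed
  interpret roofed_body B P e \<nu> r
    using B PB r \<nu>(2) descent by unfold_locales auto
  \<comment> \<open>\<open>\<epsilon> * K * t\<close> bounds the sum of all errors at scale \<open>t\<close>: twice \<open>\<epsilon> * t\<close> for the positions of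
    \<open>Y\<close> and \<open>Z\<close>, and the excess of the roof over the chord. The choice of \<open>\<epsilon>\<close> makes it half of
    the decrease \<open>t * (norm V)\<^sup>2 / 2\<close>.\<close>
  define K where "K = 2 + 2 * norm n / (\<nu> \<bullet> n)"
  have K: "0 < K" using slope_pos by (simp add: K_def add_pos_nonneg)
  define \<epsilon> where "\<epsilon> = (norm V)\<^sup>2 / (4 * K)"
  have \<epsilon>: "0 < \<epsilon>" using K \<open>0 < norm V\<close> by (simp add: \<epsilon>_def)
  have arc: "arc (g i)" and g0: "g i 0 = P" if "i \<in> I" for i
    using g[OF that] unfolding shortest_arc_def curves_on_def pathstart_def by auto
  have "\<forall>\<^sub>F t in at_right 0. \<forall>i\<in>I. \<exists>s. 0 \<le> s \<and> s \<le> 1 \<and> dist P (g i s) = t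
           \<and> norm (g i s - P - t *\<^sub>R u i) \<le> \<epsilon> * t"
    using I eventually_arc_point_at_distance[OF arc u(1) \<epsilon>] g0
    by (intro eventually_ball_finite) auto
  moreover have "\<forall>\<^sub>F t in at_right (0::real). 0 < t \<and> t < r"
    using r(1) by (intro eventually_at_rightI[of 0 r]) auto
  ultimately have "\<forall>\<^sub>F t in at_right 0. (\<forall>i\<in>I. \<exists>s. 0 \<le> s \<and> s \<le> 1 \<and> dist P (g i s) = t
           \<and> norm (g i s - P - t *\<^sub>R u i) \<le> \<epsilon> * t) \<and> 0 < t \<and> t < r"
    by (rule eventually_conj)
  from eventually_happens'[OF trivial_limit_at_right_real this]
  obtain t where t: "0 < t" "t < r" and "\<forall>i\<in>I. \<exists>s. 0 \<le> s \<and> s \<le> 1 \<and> dist P (g i s) = t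
           \<and> norm (g i s - P - t *\<^sub>R u i) \<le> \<epsilon> * t" by blast
  then obtain s where s: "\<forall>i\<in>I. 0 \<le> s i \<and> s i \<le> 1 \<and> dist P (g i (s i)) = t
           \<and> norm (g i (s i) - P - t *\<^sub>R u i) \<le> \<epsilon> * t"
    by metis
  define Y where "Y = (\<lambda>i. g i (s i))"
  have Y_dist: "dist P (Y i) = t" and Y_near: "norm (Y i - P - t *\<^sub>R u i) \<le> \<epsilon> * t" if "i \<in> I" for i
    using s that by (auto simp: Y_def)
  have Y_frontier: "Y i \<in> frontier B" if "i \<in> I" for i
    using g[OF that] s that unfolding shortest_arc_def curves_on_def path_image_def Y_def by auto
  then have Y_B: "Y i \<in> B" if "i \<in> I" for i using B(2) that by (auto simp: frontier_def)
  have Y_ball: "Y i \<in> ball P r" if "i \<in> I" for i using Y_dist[OF that] t by simp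
  have Y_height: "- (\<epsilon> * t) \<le> \<nu> \<bullet> (Y i - P)" if i: "i \<in> I" for i
  proof -
    have "\<nu> \<bullet> (Y i - P) = \<nu> \<bullet> (Y i - P - t *\<^sub>R u i)"
      using u(2)[OF i] by (simp add: inner_diff_right)
    moreover have "\<bar>\<nu> \<bullet> (Y i - P - t *\<^sub>R u i)\<bar> \<le> \<epsilon> * t"
      using Cauchy_Schwarz_ineq2[of \<nu> "Y i - P - t *\<^sub>R u i"] Y_near[OF i] \<nu>(1) by simp
    ultimately show ?thesis by linarith
  qed
  define Z where "Z = (\<Sum>i\<in>I. a i *\<^sub>R Y i)"
  have Z: "Z \<in> B" "Z \<in> ball P r"
    unfolding Z_def using a Y_B Y_ball by (auto intro!: convex_sum I B convex_ball simp del: mem_ball)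
  have Z_diff: "Z - P = (\<Sum>i\<in>I. a i *\<^sub>R (Y i - P))"
    using a(2) by (simp add: Z_def scaleR_right_diff_distrib sum_subtractf flip: scaleR_sum_left)
  have Z_height: "- (\<epsilon> * t) \<le> \<nu> \<bullet> (Z - P)"
  proof -
    have "- (\<epsilon> * t) = (\<Sum>i\<in>I. a i * - (\<epsilon> * t))"
      by (simp only: sum_distrib_right[symmetric] a(2) mult_1)
    also have "\<dots> \<le> (\<Sum>i\<in>I. a i * (\<nu> \<bullet> (Y i - P)))"
      using a(1) Y_height by (intro sum_mono mult_left_mono) auto
    finally show ?thesis by (simp add: Z_diff inner_sum_right)
  qed
  have Z_near: "norm (Z - P - t *\<^sub>R V) \<le> \<epsilon> * t"
  proof -
    have "Z - P - t *\<^sub>R V = (\<Sum>i\<in>I. a i *\<^sub>R (Y i - P - t *\<^sub>R u i))"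
      unfolding Z_diff V_def
      by (simp add: scaleR_sum_right scaleR_right_diff_distrib sum_subtractf mult.commute)
    then have "norm (Z - P - t *\<^sub>R V) \<le> (\<Sum>i\<in>I. a i * norm (Y i - P - t *\<^sub>R u i))"
      using a(1) by (auto intro!: order_trans[OF norm_sum] sum_mono)
    also have "\<dots> \<le> (\<Sum>i\<in>I. a i * (\<epsilon> * t))"
      using a(1) Y_near by (intro sum_mono mult_left_mono) auto
    finally show ?thesis using a(2) by (simp flip: sum_distrib_right)
  qed
  define X where "X = Z + roof Z *\<^sub>R n"
  have X: "X \<in> frontier B" unfolding X_def by (rule roof_frontier[OF Z(2)])
  have bound: "intrinsic_dist (frontier B) X (R i)
      \<le> intrinsic_dist (frontier B) P (R i) + t * (- (u i \<bullet> V) + (norm V)\<^sup>2 / 2 + \<epsilon> * K)"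
    if i: "i \<in> I" for i
  proof -
    obtain h G where h: "h \<in> curves_on (frontier B) X (Y i)" "length_controlled h G"
      "G 1 - G 0 \<le> norm (Y i - Z) + 2 * norm n * (\<epsilon> * t / (\<nu> \<bullet> n))"
      using short_curve_on_frontier[OF Z Z_height Y_frontier[OF i] Y_ball[OF i] Y_height[OF i]]
      unfolding X_def by blast
    have "intrinsic_dist (frontier B) X (R i)
        \<le> intrinsic_dist (frontier B) P (R i) + (G 1 - G 0) - t"
      using intrinsic_dist_detour[OF g[OF i], of "s i" h X G] h s i Y_dist[OF i]
      by (simp add: Y_def)
    moreover have "norm (Y i - Z) \<le> t * (1 - u i \<bullet> V + (norm V)\<^sup>2 / 2) + 2 * (\<epsilon> * t)"
    proof -
      have "Y i - Z = t *\<^sub>R (u i - V) + ((Y i - P - t *\<^sub>R u i) - (Z - P - t *\<^sub>R V))"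
        by (simp add: algebra_simps)
      then have "norm (Y i - Z) \<le> norm (t *\<^sub>R (u i - V))
          + norm ((Y i - P - t *\<^sub>R u i) - (Z - P - t *\<^sub>R V))"
        by (metis norm_triangle_ineq)
      also have "norm ((Y i - P - t *\<^sub>R u i) - (Z - P - t *\<^sub>R V)) \<le> \<epsilon> * t + \<epsilon> * t"
        using norm_triangle_ineq4[of "Y i - P - t *\<^sub>R u i" "Z - P - t *\<^sub>R V"] Y_near[OF i] Z_near
        by linarith
      also have "norm (t *\<^sub>R (u i - V)) \<le> t * (1 - u i \<bullet> V + (norm V)\<^sup>2 / 2)"
        using t norm_diff_le_first_order[OF norm_initial_direction[OF arc[OF i] u(1)[OF i]], of V]
        by simp
      finally show ?thesis by simp
    qed
    moreover have "t * (1 - u i \<bullet> V + (norm V)\<^sup>2 / 2) + 2 * (\<epsilon> * t)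
        + 2 * norm n * (\<epsilon> * t / (\<nu> \<bullet> n)) - t
        = t * (- (u i \<bullet> V) + (norm V)\<^sup>2 / 2 + \<epsilon> * K)"
      by (simp add: K_def algebra_simps)
    ultimately show ?thesis using h(3) by linarith
  qed
  have "(\<Sum>i\<in>I. w i * intrinsic_dist (frontier B) X (R i))
      \<le> (\<Sum>i\<in>I. w i * (intrinsic_dist (frontier B) P (R i)
            + t * (- (u i \<bullet> V) + (norm V)\<^sup>2 / 2 + \<epsilon> * K)))"
    using bound w(1) by (intro sum_mono mult_left_mono) (auto intro: less_imp_le)
  also have "\<dots> = (\<Sum>i\<in>I. w i * intrinsic_dist (frontier B) P (R i))
      + t * (- ((\<Sum>i\<in>I. w i *\<^sub>R u i) \<bullet> V) + c * ((norm V)\<^sup>2 / 2 + \<epsilon> * K))"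
    unfolding w(2)[symmetric]
    by (simp add: inner_sum_left sum_distrib_left sum_distrib_right sum.distrib sum_subtractf
        algebra_simps)
  also have "- ((\<Sum>i\<in>I. w i *\<^sub>R u i) \<bullet> V) + c * ((norm V)\<^sup>2 / 2 + \<epsilon> * K) = - (c * (norm V)\<^sup>2 / 4)"
    using K unfolding cV[symmetric]
    by (simp add: \<epsilon>_def power2_norm_eq_inner field_simps)
  finally have "t * (c * (norm V)\<^sup>2 / 4) \<le> 0" using min[OF X] by simp
  moreover have "0 < t * (c * (norm V)\<^sup>2 / 4)"
    using t(1) w(3) \<open>0 < norm V\<close> by simp
  ultimately show False by linarith
qed

section \<open>The weight ratios\<close>

lemma inverse_ft3_solution:
  assumes "inverse_ft3 c a b d x y z"
  shows "x + y + z = c" "x *\<^sub>R a + y *\<^sub>R b + z *\<^sub>R d = 0"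
  using assms unfolding inverse_ft3_def by blast+

text \<open>
  Unique solvability of the 3-inverse problem makes the linear relations between the three
  vectors a line: a relation with coefficient sum \<open>k * c\<close> minus \<open>k\<close> times the solution has sum 0, and
  adding it to the solution gives a solution again.
\<close>
lemma inverse_ft3_relation:
  assumes sol: "inverse_ft3 c a b d x y z" and "c \<noteq> 0"
    and rel: "p *\<^sub>R a + q *\<^sub>R b + s *\<^sub>R d = 0"
  obtains k where "p = k * x" "q = k * y" "s = k * z"
proof
  define k where "k = (p + q + s) / c"
  note xyz = inverse_ft3_solution[OF sol]
  have "(x + (p - k * x)) + (y + (q - k * y)) + (z + (s - k * z)) = c"
  proof -
    have "k * (x + y + z) = p + q + s" using \<open>c \<noteq> 0\<close> xyz(1) by (simp add: k_def)
    then show ?thesis using xyz(1) by (simp add: algebra_simps)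
  qed
  moreover have "(x + (p - k * x)) *\<^sub>R a + (y + (q - k * y)) *\<^sub>R b + (z + (s - k * z)) *\<^sub>R d = 0"
  proof -
    have "(x + (p - k * x)) *\<^sub>R a + (y + (q - k * y)) *\<^sub>R b + (z + (s - k * z)) *\<^sub>R d
        = (x *\<^sub>R a + y *\<^sub>R b + z *\<^sub>R d) + (p *\<^sub>R a + q *\<^sub>R b + s *\<^sub>R d)
          - k *\<^sub>R (x *\<^sub>R a + y *\<^sub>R b + z *\<^sub>R d)"
      by (simp add: algebra_simps)
    then show ?thesis using xyz(2) rel by simp
  qed
  ultimately have "x + (p - k * x) = x \<and> y + (q - k * y) = y \<and> z + (s - k * z) = z"
    using sol unfolding inverse_ft3_def by blast
  then show "p = k * x" "q = k * y" "s = k * z" by auto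
qed

text \<open>
  Eliminating \<open>e\<close> from the balance condition leaves a relation between \<open>a\<close>, \<open>b\<close> and \<open>d\<close>, hence
  a multiple of the solution \<open>x, y, z\<close>; compare the coefficients of \<open>a\<close> and \<open>b\<close>.
\<close>
lemma balanced_weight_ratio:
  assumes abd: "inverse_ft3 c a b d x y z" "x \<noteq> 0"
    and ade: "d' *\<^sub>R a + e' *\<^sub>R d + f' *\<^sub>R e = 0" "f' \<noteq> 0"
    and "c \<noteq> 0" "wa \<noteq> 0"
    and balance: "wa *\<^sub>R a + wb *\<^sub>R b + wd *\<^sub>R d + we *\<^sub>R e = 0"
  shows "wb / wa = y / x * (1 - we / wa * (d' / f'))"
proof -
  have "e = - ((d' / f') *\<^sub>R a + (e' / f') *\<^sub>R d)"
  proof -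
    have "(1 / f') *\<^sub>R (d' *\<^sub>R a + e' *\<^sub>R d + f' *\<^sub>R e) = 0" using ade(1) by simp
    then have "e + ((d' / f') *\<^sub>R a + (e' / f') *\<^sub>R d) = 0"
      using ade(2) by (simp add: scaleR_right_distrib add_ac)
    then show ?thesis by (rule iffD2[OF eq_neg_iff_add_eq_0])
  qed
  with balance have "(wa - we * (d' / f')) *\<^sub>R a + wb *\<^sub>R b + (wd - we * (e' / f')) *\<^sub>R d = 0"
    by (simp add: algebra_simps)
  then obtain k where "wa - we * (d' / f') = k * x" "wb = k * y"
    using inverse_ft3_relation[OF abd(1) \<open>c \<noteq> 0\<close>] by metis
  then have "wb = y / x * (wa - we * (d' / f'))" using abd(2) by simp
  then have "wb / wa = y / x * ((wa - we * (d' / f')) / wa)" by simp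
  also have "(wa - we * (d' / f')) / wa = 1 - we / wa * (d' / f')"
    using \<open>wa \<noteq> 0\<close> by (simp add: diff_divide_distrib)
  finally show ?thesis .
qed

text \<open>
  A vanishing coefficient would make \<open>a\<close> and \<open>b\<close> linearly dependent. As their coefficients have the
  sum \<open>c\<close>, the dependence would also be the solution for \<open>a\<close>, \<open>b\<close>, \<open>e\<close>, with weight 0 at \<open>e\<close>.
\<close>
lemma third_coefficient_nonzero:
  assumes abd: "inverse_ft3 c a b d x y z" and abe: "inverse_ft3 c a b e x' y' z'"
    and "c \<noteq> 0" "z' \<noteq> 0"
  shows "z \<noteq> 0"
proof
  assume "z = 0"
  with inverse_ft3_solution[OF abd] have "x + y = c" "x *\<^sub>R a + y *\<^sub>R b + 0 *\<^sub>R e = 0" by auto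
  with inverse_ft3_relation[OF abe \<open>c \<noteq> 0\<close>, of x y 0] obtain k
    where "x = k * x'" "y = k * y'" "0 = k * z'" by metis
  with \<open>x + y = c\<close> \<open>c \<noteq> 0\<close> \<open>z' \<noteq> 0\<close> show False by auto
qed

lemma inverse_ft3_swap:
  assumes "inverse_ft3 c a b d x y z"
  shows "inverse_ft3 c a d b x z y"
  unfolding inverse_ft3_def
proof (intro allI)
  fix p q s :: real
  have "p + s + q = c \<and> p *\<^sub>R a + s *\<^sub>R b + q *\<^sub>R d = 0 \<longleftrightarrow> p = x \<and> s = y \<and> q = z"
    using assms unfolding inverse_ft3_def by blast
  then show "p + q + s = c \<and> p *\<^sub>R a + q *\<^sub>R d + s *\<^sub>R b = 0 \<longleftrightarrow> p = x \<and> q = z \<and> s = y"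
    by (simp add: add_ac conj_commute)
qed

theorem theorem1:
  fixes M Q T :: "(real^3) set"
    and A B C D P\<^sub>F u\<^sub>A u\<^sub>B u\<^sub>C u\<^sub>D :: "real^3"
    and g\<^sub>A g\<^sub>B g\<^sub>C g\<^sub>D :: "real \<Rightarrow> real^3"
    and K1 K2 c wA wB wC wD :: real
    and wA_ABC wB_ABC wC_ABC wA_ACD wC_ACD wD_ACD wA_ABD wB_ABD wD_ABD :: real
  assumes "complete_convex_surface M"
    and "bounded_specific_curvature M K1 K2"
    and "convex_quadrilateral M A B C D Q"
    and "perimeter4 M A B C D < 2 * pi / sqrt K1"
    and "P\<^sub>F \<in> surface_interior M Q"
    and "geodesic_triangle M A B C T" and "T \<subseteq> Q"
    and "P\<^sub>F \<in> surface_interior M T"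
    and "c > 0"
    and "inverse_ft4 M A B C D P\<^sub>F c wA wB wC wD"
    and "shortest_arc M P\<^sub>F A g\<^sub>A" and "initial_direction g\<^sub>A u\<^sub>A"
    and "shortest_arc M P\<^sub>F B g\<^sub>B" and "initial_direction g\<^sub>B u\<^sub>B"
    and "shortest_arc M P\<^sub>F C g\<^sub>C" and "initial_direction g\<^sub>C u\<^sub>C"
    and "shortest_arc M P\<^sub>F D g\<^sub>D" and "initial_direction g\<^sub>D u\<^sub>D"
    and "inverse_ft3 c u\<^sub>A u\<^sub>B u\<^sub>C wA_ABC wB_ABC wC_ABC"
    and "inverse_ft3 c u\<^sub>A u\<^sub>C u\<^sub>D wA_ACD wC_ACD wD_ACD"
    and "inverse_ft3 c u\<^sub>A u\<^sub>B u\<^sub>D wA_ABD wB_ABD wD_ABD"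
    and "wA_ABC \<noteq> 0" and "wD_ACD \<noteq> 0" and "wD_ABD \<noteq> 0"
  shows "wB / wA = wB_ABC / wA_ABC * (1 - wD / wA * (wA_ACD / wD_ACD))
       \<and> wC / wA = wC_ABC / wA_ABC * (1 - wD / wA * (wA_ABD / wD_ABD))
       \<and> wA + wB + wC + wD = c"
proof -
  obtain S where S: "convex S" "closed S" "interior S \<noteq> {}" and M: "M = frontier S"
    using assms(1) unfolding complete_convex_surface_def by blast
  have w: "0 < wA" "0 < wB" "0 < wC" "0 < wD" "wA + wB + wC + wD = c"
    and P: "P\<^sub>F \<in> frontier S"
    and min: "\<And>X. X \<in> frontier S \<Longrightarrow> ft_objective (frontier S) A B C D wA wB wC wD P\<^sub>F
        \<le> ft_objective (frontier S) A B C D wA wB wC wD X"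
    using assms(10) unfolding inverse_ft4_def ft_point_def M by auto
  have c: "c \<noteq> 0" using assms(9) by simp
  have S_closed: "frontier S \<subseteq> S" using S(2) by (simp add: frontier_subset_closed)
  have direction: "u \<in> closure (feasible_directions S P\<^sub>F)"
      "u \<notin> feasible_directions (interior S) P\<^sub>F"
    if "shortest_arc M P\<^sub>F R g" "initial_direction g u" for g u R
  proof -
    have g: "arc g" "path_image g \<subseteq> frontier S" "g 0 = P\<^sub>F"
      using that(1) unfolding shortest_arc_def curves_on_def pathstart_def M by auto
    show "u \<in> closure (feasible_directions S P\<^sub>F)"
      using initial_direction_in_closure[OF g(1) that(2)] g(2,3) S_closed by auto
    show "u \<notin> feasible_directions (interior S) P\<^sub>F"
      using initial_direction_not_interior[OF S(1,2) g(1) that(2)] g(2,3) by auto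
  qed
  have ACB: "inverse_ft3 c u\<^sub>A u\<^sub>C u\<^sub>B wA_ABC wC_ABC wB_ABC"
    using assms(19) by (rule inverse_ft3_swap)
  have nz: "wC_ABC \<noteq> 0" "wB_ABC \<noteq> 0"
    using third_coefficient_nonzero[OF assms(19,21) c assms(24)]
      third_coefficient_nonzero[OF ACB assms(20) c assms(23)] by auto
  note ABC0 = inverse_ft3_solution(2)[OF assms(19)]
    and ACD0 = inverse_ft3_solution(2)[OF assms(20)]
    and ABD0 = inverse_ft3_solution(2)[OF assms(21)]
  have uC: "u\<^sub>C = (- wA_ABC / wC_ABC) *\<^sub>R u\<^sub>A + (- wB_ABC / wC_ABC) *\<^sub>R u\<^sub>B"
  proof -
    have "(1 / wC_ABC) *\<^sub>R (wA_ABC *\<^sub>R u\<^sub>A + wB_ABC *\<^sub>R u\<^sub>B + wC_ABC *\<^sub>R u\<^sub>C) = 0"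
      using ABC0 by simp
    then have "u\<^sub>C + ((wA_ABC / wC_ABC) *\<^sub>R u\<^sub>A + (wB_ABC / wC_ABC) *\<^sub>R u\<^sub>B) = 0"
      using nz by (simp add: scaleR_right_distrib add_ac)
    then show ?thesis by (simp add: add_eq_0_iff2)
  qed
  obtain \<nu> where \<nu>: "norm \<nu> = 1" "\<And>z. z \<in> S \<Longrightarrow> \<nu> \<bullet> (z - P\<^sub>F) \<le> 0"
    and \<nu>A: "\<nu> \<bullet> u\<^sub>A = 0" and \<nu>B: "\<nu> \<bullet> u\<^sub>B = 0"
    using supporting_plane_through_three_directions[OF S P direction[OF assms(11,12)]
        direction[OF assms(13,14)] direction[OF assms(15,16)] uC] nz assms(22) by auto
  have \<nu>C: "\<nu> \<bullet> u\<^sub>C = 0" unfolding uC using \<nu>A \<nu>B by (simp add: inner_simps)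
  have \<nu>D: "\<nu> \<bullet> u\<^sub>D = 0"
  proof -
    have "\<nu> \<bullet> (wA_ACD *\<^sub>R u\<^sub>A + wC_ACD *\<^sub>R u\<^sub>C + wD_ACD *\<^sub>R u\<^sub>D) = 0" using ACD0 by simp
    then show ?thesis using \<nu>A \<nu>C assms(23) by (simp add: inner_simps)
  qed
  have sum4: "(\<Sum>i\<in>{0, 1, 2, 3}. f i) = f 0 + f 1 + f 2 + f 3" for f :: "nat \<Rightarrow> 'b :: comm_monoid_add"
    by (simp add: add_ac)
  have "(\<Sum>i\<in>{0, 1, 2, 3}. ([wA, wB, wC, wD] ! i) *\<^sub>R ([u\<^sub>A, u\<^sub>B, u\<^sub>C, u\<^sub>D] ! i)) = 0"
  proof (rule weighted_directions_balance[OF S \<nu>, where c = c and R = "(!) [A, B, C, D]"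
        and g = "(!) [g\<^sub>A, g\<^sub>B, g\<^sub>C, g\<^sub>D]"])
    show "sum ((!) [wA, wB, wC, wD]) {0, 1, 2, 3} = c"
      unfolding sum4 using w(5) by (simp add: numeral_3_eq_3)
    show "(\<Sum>i\<in>{0, 1, 2, 3}. [wA, wB, wC, wD] ! i * intrinsic_dist (frontier S) P\<^sub>F ([A, B, C, D] ! i))
        \<le> (\<Sum>i\<in>{0, 1, 2, 3}. [wA, wB, wC, wD] ! i * intrinsic_dist (frontier S) X ([A, B, C, D] ! i))"
      if "X \<in> frontier S" for X
      unfolding sum4 using min[OF that] by (simp add: numeral_3_eq_3 ft_objective_def)
  qed (use w P assms(9) \<nu>A \<nu>B \<nu>C \<nu>D assms(11-18)[unfolded M] in \<open>auto simp: numeral_3_eq_3\<close>)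
  then have balance: "wA *\<^sub>R u\<^sub>A + wB *\<^sub>R u\<^sub>B + wC *\<^sub>R u\<^sub>C + wD *\<^sub>R u\<^sub>D = 0"
    unfolding sum4 by (simp add: numeral_3_eq_3)
  then have balance': "wA *\<^sub>R u\<^sub>A + wC *\<^sub>R u\<^sub>C + wB *\<^sub>R u\<^sub>B + wD *\<^sub>R u\<^sub>D = 0"
    by (simp add: add_ac)
  have wA: "wA \<noteq> 0" using w(1) by simp
  show ?thesis
    using balanced_weight_ratio[OF assms(19,22) ACD0 assms(23) c wA balance]
      balanced_weight_ratio[OF ACB assms(22) ABD0 assms(24) c wA balance'] w(5)
    by blast
qed

end
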